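(* Let $\mathsf{M}=(m_x)_{x\in X}$ be a transition probability kernel on a compact metric space $X$ satisfying the Feller property, and let $f\in C_b(X,\mathbb{R})$ be a normalized potential. Let $\mathscr{L}_{\mathsf{M},f}$ be the associated transfer operator, let $\widetilde{\mathsf{M}}=(\widetilde m_x)_{x\in X}$ be the transition probability kernel $\widetilde m_x(A)=\mathscr{L}_{\mathsf{M},f}(\mathbf{1}_A)(x)$, and let $\Psi=(\Psi_n)_{n\geqslant0}$ be the associated Markov chain starting at a point $x\in X$. Then with probability $1$, every accumulation point (in the weak-$*$ topology) of the sequence $$\frac1n\sum_{i=0}^{n-1}\delta_{\Psi_i}$$ is a stationary measure of $\Psi$. In particular such a limit $\nu$ satisfies $\mathscr{L}_{\mathsf{M},f}^*\nu=\nu$, i.e. $\nu$ is a fixed point of the dual of the transfer operator.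
   Context: A transition probability kernel is a family $(m_x)_{x\in X}$ of Borel probability measures on $X$ such that $x\mapsto m_x(A)$ is measurable for every Borel set $A$; it has the Feller property if $x\mapsto\int_X\varphi\,dm_x$ is bounded continuous for every bounded continuous $\varphi$. $C_b(X,\mathbb{R})$ denotes the bounded continuous real functions. The transfer operator is $\mathscr{L}_{\mathsf{M},f}\varphi(x)=\int_Xe^{f(y)}\varphi(y)\,dm_x(y)$; $f$ is normalized if $\mathscr{L}_{\mathsf{M},f}\mathbf{1}=\mathbf{1}$. A stationary measure of $\Psi$ is a Borel probability measure $\nu$ with $\int_X\widetilde m_x(A)\,d\nu(x)=\nu(A)$ for every Borel $A$. $\mathscr{L}_{\mathsf{M},f}^*\nu=\nu$ means $\int\mathscr{L}_{\mathsf{M},f}\varphi\,d\nu=\int\varphi\,d\nu$ for all $\varphi\in C_b(X,\mathbb{R})$. *)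

theory Defs
  imports "HOL-Probability.Probability"
begin

definition transition_kernel :: "('a::topological_space \<Rightarrow> 'a measure) \<Rightarrow> bool" where
  "transition_kernel m \<longleftrightarrow>
     (\<forall>x. prob_space (m x) \<and> sets (m x) = sets borel) \<and>
     (\<forall>A\<in>sets borel. (\<lambda>x. measure (m x) A) \<in> borel_measurable borel)"

text \<open>The library's \<open>bcontfun\<close> is the set of bounded continuous functions, here $C_b(X,\mathbb{R})$.\<close>

definition feller :: "('a::topological_space \<Rightarrow> 'a measure) \<Rightarrow> bool" where
  "feller m \<longleftrightarrow>
     (\<forall>\<phi> :: 'a \<Rightarrow> real. \<phi> \<in> bcontfun \<longrightarrow> (\<lambda>x. \<integral>y. \<phi> y \<partial>m x) \<in> bcontfun)"

definition transfer_operator ::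
    "('a \<Rightarrow> 'a measure) \<Rightarrow> ('a \<Rightarrow> real) \<Rightarrow> ('a \<Rightarrow> real) \<Rightarrow> 'a \<Rightarrow> real" where
  "transfer_operator m f \<phi> x = (\<integral>y. exp (f y) * \<phi> y \<partial>m x)"

definition normalized_potential :: "('a \<Rightarrow> 'a measure) \<Rightarrow> ('a \<Rightarrow> real) \<Rightarrow> bool" where
  "normalized_potential m f \<longleftrightarrow> transfer_operator m f (\<lambda>_. 1) = (\<lambda>_. 1)"

definition tilted_kernel ::
    "('a::topological_space \<Rightarrow> 'a measure) \<Rightarrow> ('a \<Rightarrow> real) \<Rightarrow> 'a \<Rightarrow> 'a measure" where
  "tilted_kernel m f x =
     measure_of UNIV (sets borel) (\<lambda>A. ennreal (transfer_operator m f (indicator A) x))"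

definition stationary_measure ::
    "('a::topological_space \<Rightarrow> 'a measure) \<Rightarrow> 'a measure \<Rightarrow> bool" where
  "stationary_measure K \<nu> \<longleftrightarrow>
     prob_space \<nu> \<and> sets \<nu> = sets borel \<and>
     (\<forall>A\<in>sets borel. (\<integral>\<^sup>+x. emeasure (K x) A \<partial>\<nu>) = emeasure \<nu> A)"

definition dual_fixed_point ::
    "('a::topological_space \<Rightarrow> 'a measure) \<Rightarrow> ('a \<Rightarrow> real) \<Rightarrow> 'a measure \<Rightarrow> bool" where
  "dual_fixed_point m f \<nu> \<longleftrightarrow>
     (\<forall>\<phi>\<in>bcontfun. (\<integral>x. transfer_operator m f \<phi> x \<partial>\<nu>) = (\<integral>x. \<phi> x \<partial>\<nu>))"

definition past :: "'w measure \<Rightarrow> (nat \<Rightarrow> 'w \<Rightarrow> 'a::topological_space) \<Rightarrow> nat \<Rightarrow> 'w measure" where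
  "past P \<Psi> n = sigma (space P) {\<Psi> i -` A \<inter> space P | i A. i \<le> n \<and> A \<in> sets borel}"

text \<open>A process \<open>\<Psi>\<close>, defined on an arbitrary probability space \<open>P\<close>, is a (time-homogeneous) Markov
  chain with kernel \<open>K\<close> starting at \<open>x\<close> if $\Psi_0 = x$ and
  $P(\Psi_{n+1}\in A \mid \Psi_0,\dots,\Psi_n) = K_{\Psi_n}(A)$ almost surely.\<close>

definition markov_chain ::
    "'w measure \<Rightarrow> ('a::topological_space \<Rightarrow> 'a measure) \<Rightarrow> 'a \<Rightarrow> (nat \<Rightarrow> 'w \<Rightarrow> 'a) \<Rightarrow> bool" where
  "markov_chain P K x \<Psi> \<longleftrightarrow>
     prob_space P \<and> (\<forall>n. \<Psi> n \<in> borel_measurable P) \<and> (AE \<omega> in P. \<Psi> 0 \<omega> = x) \<and>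
     (\<forall>n. \<forall>A\<in>sets borel. AE \<omega> in P.
        real_cond_exp P (past P \<Psi> n) (\<lambda>\<omega>. indicator A (\<Psi> (Suc n) \<omega>)) \<omega> = measure (K (\<Psi> n \<omega>)) A)"

text \<open>The measure $\frac1n\sum_{i<n}\delta_{x_i}$; it is a probability measure for \<open>n > 0\<close> and null
  for \<open>n = 0\<close>.\<close>

definition empirical_measure :: "(nat \<Rightarrow> 'a::topological_space) \<Rightarrow> nat \<Rightarrow> 'a measure" where
  "empirical_measure x n =
     measure_of UNIV (sets borel)
       (\<lambda>A. ennreal (1 / real n) * (\<Sum>i<n. emeasure (return borel (x i)) A))"

text \<open>The weak-$*$ topology on the Borel probability measures: the coarsest topology making all
  evaluations $\nu\mapsto\int\varphi\,d\nu$, $\varphi\in C_b(X,\mathbb{R})$, continuous.\<close>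

definition weak_star_topology :: "'a::topological_space measure topology" where
  "weak_star_topology = topology_generated_by
     {{\<nu>. prob_space \<nu> \<and> sets \<nu> = sets borel \<and> (\<integral>x. \<phi> x \<partial>\<nu>) \<in> U} | (\<phi> :: 'a \<Rightarrow> real) U.
        \<phi> \<in> bcontfun \<and> open U}"

definition accumulation_point_of :: "'b topology \<Rightarrow> (nat \<Rightarrow> 'b) \<Rightarrow> 'b \<Rightarrow> bool" where
  "accumulation_point_of T s l \<longleftrightarrow>
     l \<in> topspace T \<and> (\<forall>U. openin T U \<longrightarrow> l \<in> U \<longrightarrow> (\<exists>\<^sub>F n in sequentially. s n \<in> U))"

lemma topspace_weak_star_topology:
  "topspace weak_star_topology = {\<nu>. prob_space \<nu> \<and> sets \<nu> = sets (borel :: 'a::topological_space measure)}"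
proof -
  have "(\<lambda>_. 0 :: real) \<in> (bcontfun :: ('a \<Rightarrow> real) set)"
    by (simp add: bcontfun_def)
  then show ?thesis
    unfolding weak_star_topology_def topology_generated_by_topspace by blast
qed

text \<open>The set functions in the two uses of \<open>measure_of\<close> above are measures, so \<open>emeasure\<close> returns
  exactly the prescribed values.\<close>

lemma emeasure_tilted_kernel:
  fixes f :: "'a::topological_space \<Rightarrow> real"
  assumes m: "transition_kernel m" and f: "f \<in> bcontfun" and A: "A \<in> sets borel"
  shows "emeasure (tilted_kernel m f x) A = ennreal (transfer_operator m f (indicator A) x)"
proof -
  have sm[measurable_cong]: "sets (m x) = sets borel" and "prob_space (m x)"
    using m by (auto simp: transition_kernel_def)
  then interpret prob_space "m x" by simp
  have f_meas[measurable]: "f \<in> borel_measurable borel"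
    using f by (auto simp: bcontfun_def intro: borel_measurable_continuous_onI)
  obtain B where B: "\<And>y. \<bar>f y\<bar> \<le> B"
    using f by (auto simp: bcontfun_def bounded_iff)
  have int: "integrable (m x) (\<lambda>y. exp (f y) * indicator C y)" if "C \<in> sets borel" for C
  proof (rule integrable_const_bound[where B = "exp B"])
    show "AE y in m x. norm (exp (f y) * indicator C y) \<le> exp B"
      using B by (auto simp: indicator_def abs_le_iff)
    show "(\<lambda>y. exp (f y) * indicator C y) \<in> borel_measurable (m x)"
      using that by measurable
  qed
  have eq: "ennreal (transfer_operator m f (indicator C) x) = emeasure (density (m x) (\<lambda>y. ennreal (exp (f y)))) C"
    if C: "C \<in> sets borel" for C
  proof -
    have "emeasure (density (m x) (\<lambda>y. ennreal (exp (f y)))) C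
        = (\<integral>\<^sup>+y. ennreal (exp (f y) * indicator C y) \<partial>m x)"
      using C sm by (subst emeasure_density) (auto simp: ennreal_mult' ennreal_indicator)
    also have "\<dots> = ennreal (transfer_operator m f (indicator C) x)"
      unfolding transfer_operator_def
      by (rule nn_integral_eq_integral[OF int[OF C]]) simp
    finally show ?thesis by simp
  qed
  have "measure_space UNIV (sets borel) (\<lambda>A. ennreal (transfer_operator m f (indicator A) x))"
  proof -
    have "space (m x) = UNIV"
      using sets_eq_imp_space_eq[OF sm] by simp
    then have "measure_space UNIV (sets borel) (emeasure (density (m x) (\<lambda>y. ennreal (exp (f y)))))"
      using measure_space[of "density (m x) (\<lambda>y. ennreal (exp (f y)))"] sm by simp
    then show ?thesis
      using eq measure_space_eq[of "sets borel" UNIV "emeasure (density (m x) (\<lambda>y. ennreal (exp (f y))))"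
          "\<lambda>A. ennreal (transfer_operator m f (indicator A) x)"]
      by (auto simp: sets.space_closed sets.sigma_sets_eq[of borel, simplified])
  qed
  then show ?thesis
    unfolding tilted_kernel_def
    using A by (intro emeasure_measure_of_sigma)
      (auto simp: measure_space_def)
qed

lemma emeasure_empirical_measure:
  assumes A: "A \<in> sets (borel :: 'a::topological_space measure)"
  shows "emeasure (empirical_measure x n) A = ennreal (1 / real n) * (\<Sum>i<n. emeasure (return borel (x i)) A)"
  unfolding empirical_measure_def
proof (rule emeasure_measure_of_sigma[OF _ _ _ A])
  show "sigma_algebra UNIV (sets (borel :: 'a measure))"
    using sets.sigma_algebra_axioms[of "borel :: 'a measure"] by simp
  show "positive (sets borel) (\<lambda>A. ennreal (1 / real n) * (\<Sum>i<n. emeasure (return borel (x i)) A))"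
    by (simp add: positive_def)
  show "countably_additive (sets borel) (\<lambda>A. ennreal (1 / real n) * (\<Sum>i<n. emeasure (return borel (x i)) A))"
    unfolding countably_additive_def
  proof (intro allI impI)
    fix F :: "nat \<Rightarrow> 'a set"
    assume F: "range F \<subseteq> sets borel" "disjoint_family F"
    have "(\<Sum>k. ennreal (1 / real n) * (\<Sum>i<n. emeasure (return borel (x i)) (F k)))
        = ennreal (1 / real n) * (\<Sum>i<n. \<Sum>k. emeasure (return borel (x i)) (F k))"
      by (simp add: ennreal_suminf_cmult suminf_sum)
    also have "(\<Sum>i<n. \<Sum>k. emeasure (return borel (x i)) (F k))
        = (\<Sum>i<n. emeasure (return borel (x i)) (\<Union>k. F k))"
      using F by (intro sum.cong refl suminf_emeasure) auto
    finally show "(\<Sum>k. ennreal (1 / real n) * (\<Sum>i<n. emeasure (return borel (x i)) (F k)))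
        = ennreal (1 / real n) * (\<Sum>i<n. emeasure (return borel (x i)) (\<Union>k. F k))" .
  qed
qed

lemma transition_kernel_tilted_kernel:
  fixes f :: "'a::topological_space \<Rightarrow> real"
  assumes m: "transition_kernel m" and f: "f \<in> bcontfun" and n: "normalized_potential m f"
  shows "transition_kernel (tilted_kernel m f)"
  unfolding transition_kernel_def
proof (intro conjI allI ballI)
  fix x
  show s: "sets (tilted_kernel m f x) = sets borel"
    using sets.sigma_sets_eq[of "borel :: 'a measure"] by (simp add: tilted_kernel_def)
  have "emeasure (tilted_kernel m f x) UNIV = 1"
    using n emeasure_tilted_kernel[OF m f, of UNIV x]
    by (simp add: normalized_potential_def indicator_def fun_eq_iff)
  then show "prob_space (tilted_kernel m f x)"
    using sets_eq_imp_space_eq[OF s] by (intro prob_spaceI) simp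
next
  fix A :: "'a set" assume A[measurable]: "A \<in> sets borel"
  have f_meas[measurable]: "f \<in> borel_measurable borel"
    using f by (auto simp: bcontfun_def intro: borel_measurable_continuous_onI)
  have "m \<in> measurable borel (prob_algebra borel)"
    using m by (intro measurable_prob_algebraI measurable_subprob_algebra)
      (auto simp: transition_kernel_def prob_space_imp_subprob_space
        finite_measure.emeasure_eq_measure prob_space.finite_measure)
  then have m_meas[measurable]: "m \<in> measurable borel (subprob_algebra borel)"
    by (rule measurable_prob_algebraD)
  have nonneg: "0 \<le> transfer_operator m f (indicator A) x" for x
    unfolding transfer_operator_def by (intro integral_nonneg_AE) simp
  have "measure (tilted_kernel m f x) A = transfer_operator m f (indicator A) x" for x
    using emeasure_tilted_kernel[OF m f A, of x] nonneg by (simp add: measure_def)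
  moreover have "(\<lambda>x. transfer_operator m f (indicator A) x) \<in> borel_measurable borel"
    unfolding transfer_operator_def
    by (rule measurable_compose[OF m_meas integral_measurable_subprob_algebra]) measurable
  ultimately show "(\<lambda>x. measure (tilted_kernel m f x) A) \<in> borel_measurable borel"
    by simp
qed

end

theory Submission
  imports Defs
begin

text \<open>
  For bounded \<open>\<phi>\<close>, the differences \<open>\<phi>(\<Psi>\<^bsub>i+1\<^esub>) - \<integral>\<phi> dK\<^bsub>\<Psi> i\<^esub>\<close>, where \<open>K\<close> is the tilted kernel, are
  bounded martingale increments, so their averages tend to 0 almost surely. After telescoping, every
  accumulation point \<open>\<nu>\<close> of the empirical measures satisfies \<open>\<integral>\<integral>\<phi> dK d\<nu> = \<integral>\<phi> d\<nu>\<close> as soon as the inner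
  integral is continuous, which is the Feller property of \<open>K\<close>. The exceptional null set may depend on
  \<open>\<phi>\<close>, so this is done only for countably many \<open>\<phi>\<close>: the functions increasing to the indicators of a
  countable family of open sets that is closed under intersection and generates the Borel sets.
  That already forces \<open>\<nu>K = \<nu>\<close>.
\<close>

section \<open>A strong law for bounded orthogonal increments\<close>

text \<open>Orthogonality removes the cross terms, so the second moment of the \<open>n\<close>-th
  partial sum is at most \<open>n * C^2\<close>. Along \<open>n = k^2\<close> the averages then have
  second moments at most \<open>C^2 / k^2\<close>, which is summable; boundedness of the increments
  controls the partial sums between squares.\<close>

lemma (in prob_space) strong_law_orthogonal_increments:
  fixes D :: "nat \<Rightarrow> 'a \<Rightarrow> real"
  assumes meas[measurable]: "\<And>i. D i \<in> borel_measurable M"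
    and bound: "\<And>i \<omega>. \<bar>D i \<omega>\<bar> \<le> C"
    and orth: "\<And>n. expectation (\<lambda>\<omega>. (\<Sum>i<n. D i \<omega>) * D n \<omega>) = 0"
  shows "AE \<omega> in M. (\<lambda>n. (\<Sum>i<n. D i \<omega>) / real n) \<longlonglongrightarrow> 0"
proof -
  define S where "S n \<omega> = (\<Sum>i<n. D i \<omega>)" for n \<omega>
  have S_meas[measurable]: "S n \<in> borel_measurable M" for n
    unfolding S_def by measurable
  have C0: "C \<ge> 0"
    using bound[of 0] abs_ge_zero order_trans by blast
  have incr: "\<bar>S n \<omega> - S k \<omega>\<bar> \<le> C * real (n - k)" if "k \<le> n" for n k \<omega>
  proof -
    have "S n \<omega> - S k \<omega> = (\<Sum>i=k..<n. D i \<omega>)"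
      using that sum_diff_nat_ivl[of 0 k n "\<lambda>i. D i \<omega>"] by (simp add: S_def atLeast0LessThan)
    also have "\<bar>\<dots>\<bar> \<le> (\<Sum>i=k..<n. C)"
      by (rule order_trans[OF sum_abs sum_mono]) (rule bound)
    finally show ?thesis by (simp add: mult.commute)
  qed
  have S_bound: "\<bar>S n \<omega>\<bar> \<le> C * real n" for n \<omega>
    using incr[of 0 n \<omega>] by (simp add: S_def)
  have int2: "integrable M (\<lambda>\<omega>. g \<omega> * h \<omega>)"
    if [measurable]: "g \<in> borel_measurable M" "h \<in> borel_measurable M"
      and "\<And>\<omega>. \<bar>g \<omega>\<bar> \<le> a" "\<And>\<omega>. \<bar>h \<omega>\<bar> \<le> b" for g h and a b :: real
  proof (rule integrable_const_bound[where B = "a * b"])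
    show "AE \<omega> in M. norm (g \<omega> * h \<omega>) \<le> a * b"
      using that by (intro AE_I2) (simp add: abs_mult mult_mono')
  qed measurable
  have second_moment: "expectation (\<lambda>\<omega>. S n \<omega> * S n \<omega>) \<le> real n * C\<^sup>2" for n
  proof (induction n)
    case 0
    show ?case by (simp add: S_def)
  next
    case (Suc n)
    have 1: "integrable M (\<lambda>\<omega>. S n \<omega> * S n \<omega>)" "integrable M (\<lambda>\<omega>. S n \<omega> * D n \<omega>)"
      "integrable M (\<lambda>\<omega>. D n \<omega> * D n \<omega>)"
      by (rule int2[OF _ _ S_bound S_bound] int2[OF _ _ S_bound bound] int2[OF _ _ bound bound]; measurable)+
    have "S (Suc n) \<omega> * S (Suc n) \<omega> = S n \<omega> * S n \<omega> + 2 * (S n \<omega> * D n \<omega>) + D n \<omega> * D n \<omega>" for \<omega>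
      by (simp add: S_def algebra_simps)
    then have "expectation (\<lambda>\<omega>. S (Suc n) \<omega> * S (Suc n) \<omega>)
        = expectation (\<lambda>\<omega>. S n \<omega> * S n \<omega>) + 2 * expectation (\<lambda>\<omega>. S n \<omega> * D n \<omega>)
          + expectation (\<lambda>\<omega>. D n \<omega> * D n \<omega>)"
      using 1 by simp
    also have "expectation (\<lambda>\<omega>. S n \<omega> * D n \<omega>) = 0"
      using orth[of n] by (simp add: S_def)
    also have "expectation (\<lambda>\<omega>. D n \<omega> * D n \<omega>) \<le> expectation (\<lambda>\<omega>. C\<^sup>2)"
      using bound C0 by (intro integral_mono 1)
        (auto simp flip: power2_eq_square abs_le_square_iff)
    finally show ?case
      using Suc by (simp add: prob_space algebra_simps)
  qed
  \<comment> \<open>A nonnegative series with finite expectation is almost surely finite, and then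
    its terms tend to 0; no Borel-Cantelli argument is required. The term \<open>k = 0\<close> is
    harmless: division by zero gives 0 on both sides of the estimate.\<close>
  have "(\<integral>\<^sup>+\<omega>. (\<Sum>k. ennreal ((S (k\<^sup>2) \<omega> / real (k\<^sup>2))\<^sup>2)) \<partial>M)
      = (\<Sum>k. \<integral>\<^sup>+\<omega>. ennreal ((S (k\<^sup>2) \<omega> / real (k\<^sup>2))\<^sup>2) \<partial>M)"
    by (rule nn_integral_suminf) measurable
  also have "\<dots> \<le> (\<Sum>k. ennreal (C\<^sup>2 * inverse (real k ^ 2)))"
  proof (intro suminf_le)
    fix k
    have int: "integrable M (\<lambda>\<omega>. S (k\<^sup>2) \<omega> * S (k\<^sup>2) \<omega>)"
      by (rule int2[OF _ _ S_bound S_bound]; measurable)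
    have "(\<integral>\<^sup>+\<omega>. ennreal ((S (k\<^sup>2) \<omega> / real (k\<^sup>2))\<^sup>2) \<partial>M)
        = ennreal (expectation (\<lambda>\<omega>. (S (k\<^sup>2) \<omega> * S (k\<^sup>2) \<omega>) / (real (k\<^sup>2))\<^sup>2))"
      using int by (subst nn_integral_eq_integral[symmetric])
        (simp_all add: power2_eq_square field_simps)
    also have "\<dots> \<le> ennreal (C\<^sup>2 * inverse (real k ^ 2))"
    proof (rule ennreal_leI)
      have "expectation (\<lambda>\<omega>. (S (k\<^sup>2) \<omega> * S (k\<^sup>2) \<omega>) / (real (k\<^sup>2))\<^sup>2)
          \<le> real (k\<^sup>2) * C\<^sup>2 / (real (k\<^sup>2))\<^sup>2"
        using second_moment[of "k\<^sup>2"] int by (simp add: divide_right_mono)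
      also have "\<dots> = C\<^sup>2 * inverse (real k ^ 2)"
        by (simp add: power2_eq_square field_simps)
      finally show "expectation (\<lambda>\<omega>. (S (k\<^sup>2) \<omega> * S (k\<^sup>2) \<omega>) / (real (k\<^sup>2))\<^sup>2) \<le> C\<^sup>2 * inverse (real k ^ 2)" .
    qed
    finally show "(\<integral>\<^sup>+\<omega>. ennreal ((S (k\<^sup>2) \<omega> / real (k\<^sup>2))\<^sup>2) \<partial>M) \<le> ennreal (C\<^sup>2 * inverse (real k ^ 2))" .
  qed (rule summableI)+
  also have "\<dots> < \<infinity>"
  proof (subst suminf_ennreal2)
    show "summable (\<lambda>k. C\<^sup>2 * inverse (real k ^ 2))"
      by (intro summable_mult inverse_power_summable) simp
  qed simp_all
  finally have "AE \<omega> in M. (\<Sum>k. ennreal ((S (k\<^sup>2) \<omega> / real (k\<^sup>2))\<^sup>2)) \<noteq> \<infinity>"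
    by (intro nn_integral_PInf_AE) auto
  then show ?thesis
  proof (rule AE_mp, intro AE_I2 impI)
    fix \<omega>
    assume "(\<Sum>k. ennreal ((S (k\<^sup>2) \<omega> / real (k\<^sup>2))\<^sup>2)) \<noteq> \<infinity>"
    then have "summable (\<lambda>k. (S (k\<^sup>2) \<omega> / real (k\<^sup>2))\<^sup>2)"
      by (intro summable_suminf_not_top) auto
    then have "(\<lambda>k. (S (k\<^sup>2) \<omega> / real (k\<^sup>2))\<^sup>2) \<longlonglongrightarrow> 0"
      by (rule summable_LIMSEQ_zero)
    then have squares: "(\<lambda>k. \<bar>S (k\<^sup>2) \<omega> / real (k\<^sup>2)\<bar>) \<longlonglongrightarrow> 0"
      using tendsto_real_sqrt by fastforce
    \<comment> \<open>Between consecutive squares the partial sums move by \<open>O(\<surd>n)\<close>, so the limit along squares suffices.\<close>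
    define r where "r n = nat \<lfloor>sqrt (real n)\<rfloor>" for n
    have r_le: "real (r n) \<le> sqrt (real n)" and r_gt: "sqrt (real n) < real (r n) + 1" for n
      unfolding r_def by (simp_all, linarith?)
    have sqrt_top: "filterlim (\<lambda>n. sqrt (real n)) at_top sequentially"
      by (rule filterlim_compose[OF sqrt_at_top filterlim_real_sequentially])
    have r_top: "filterlim r at_top sequentially"
      unfolding r_def
      by (rule filterlim_compose[OF filterlim_nat_sequentially filterlim_compose[OF filterlim_floor_sequentially sqrt_top]])
    have lim: "(\<lambda>n. \<bar>S ((r n)\<^sup>2) \<omega> / real ((r n)\<^sup>2)\<bar> + 3 * C / sqrt (real n)) \<longlonglongrightarrow> 0"
      by (rule tendsto_add_zero[OF filterlim_compose[OF squares r_top]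
            tendsto_divide_0[OF tendsto_const filterlim_at_top_imp_at_infinity[OF sqrt_top]]])
    have "\<bar>S n \<omega> / real n\<bar> \<le> \<bar>S ((r n)\<^sup>2) \<omega> / real ((r n)\<^sup>2)\<bar> + 3 * C / sqrt (real n)" if n: "n > 0" for n
    proof -
      have "real ((r n)\<^sup>2) \<le> real n"
        using power_mono[OF r_le[of n], of 2] by simp
      then have le: "(r n)\<^sup>2 \<le> n"
        by (simp only: of_nat_le_iff)
      have s1: "1 \<le> sqrt (real n)" using n by simp
      then have "real (r n) > 0"
        using r_gt[of n] by linarith
      then have pos: "real ((r n)\<^sup>2) > 0"
        by simp
      \<comment> \<open>The distance from \<open>n\<close> down to the last square is below
        \<open>2 * r n + 1\<close>. Since \<open>n > 0\<close> forces \<open>r n\<close> to be at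
        least 1, this is at most \<open>3 * r n\<close>, which is the origin of the constant 3 in
        \<open>lim\<close>.\<close>
      have "real n < (real (r n) + 1)\<^sup>2"
        using power_strict_mono[OF r_gt[of n], of 2] by simp
      then have "real (n - (r n)\<^sup>2) < 2 * real (r n) + 1"
        using le by (simp add: of_nat_diff power2_eq_square algebra_simps)
      moreover have "1 \<le> real (r n)"
        using \<open>real (r n) > 0\<close> by simp
      ultimately have "real (n - (r n)\<^sup>2) \<le> 3 * real (r n)"
        by linarith
      then have gap: "real (n - (r n)\<^sup>2) \<le> 3 * sqrt (real n)"
        using r_le[of n] by linarith
      have "\<bar>S n \<omega>\<bar> \<le> \<bar>S ((r n)\<^sup>2) \<omega>\<bar> + C * (3 * sqrt (real n))"
        using incr[OF le, of \<omega>] mult_left_mono[OF gap C0] by linarith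
      then have "\<bar>S n \<omega>\<bar> / real n \<le> \<bar>S ((r n)\<^sup>2) \<omega>\<bar> / real n + C * (3 * sqrt (real n)) / real n"
        using n by (simp add: divide_right_mono add_divide_distrib[symmetric])
      also have "\<bar>S ((r n)\<^sup>2) \<omega>\<bar> / real n \<le> \<bar>S ((r n)\<^sup>2) \<omega>\<bar> / real ((r n)\<^sup>2)"
        using le pos n by (intro divide_left_mono) auto
      also have "C * (3 * sqrt (real n)) / real n = 3 * C / sqrt (real n)"
        using n by (simp add: field_simps)
      finally show ?thesis by simp
    qed
    then have "eventually (\<lambda>n. norm (S n \<omega> / real n) \<le> \<bar>S ((r n)\<^sup>2) \<omega> / real ((r n)\<^sup>2)\<bar> + 3 * C / sqrt (real n)) sequentially"
      by (intro eventually_mono[OF eventually_gt_at_top[of 0]]) simp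
    then have "(\<lambda>n. S n \<omega> / real n) \<longlonglongrightarrow> 0"
      using lim by (rule Lim_null_comparison)
    then show "(\<lambda>n. (\<Sum>i<n. D i \<omega>) / real n) \<longlonglongrightarrow> 0"
      by (simp add: S_def)
  qed
qed

section \<open>The tilted kernel as a density, and its Feller property\<close>

lemma bcontfun_measurable:
  assumes "\<phi> \<in> bcontfun"
  shows "\<phi> \<in> borel_measurable borel"
  using assms by (auto simp: bcontfun_def intro: borel_measurable_continuous_onI)

lemma bcontfun_abs_bounded:
  fixes \<phi> :: "'a::topological_space \<Rightarrow> real"
  assumes "\<phi> \<in> bcontfun"
  shows "\<exists>B. \<forall>y. \<bar>\<phi> y\<bar> \<le> B"
  using assms by (auto simp: bcontfun_def bounded_iff)

text \<open>The kernel is given by its values on Borel sets. The density form, which has the same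
  values, is what allows functions other than indicators to be integrated against it.\<close>

lemma tilted_kernel_eq_density:
  fixes f :: "'a::topological_space \<Rightarrow> real"
  assumes m: "transition_kernel m" and f: "f \<in> bcontfun"
  shows "tilted_kernel m f x = density (m x) (\<lambda>y. ennreal (exp (f y)))"
proof (rule measure_eqI)
  have [measurable_cong]: "sets (m x) = sets borel" and "prob_space (m x)"
    using m by (auto simp: transition_kernel_def)
  then interpret prob_space "m x" by simp
  note bcontfun_measurable[OF f, measurable]
  obtain B where B: "\<And>y. \<bar>f y\<bar> \<le> B"
    using bcontfun_abs_bounded[OF f] by blast
  show s: "sets (tilted_kernel m f x) = sets (density (m x) (\<lambda>y. ennreal (exp (f y))))"
    using sets.sigma_sets_eq[of "borel :: 'a measure"] \<open>sets (m x) = sets borel\<close>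
    by (simp add: tilted_kernel_def)
  fix A assume "A \<in> sets (tilted_kernel m f x)"
  then have A[measurable]: "A \<in> sets borel"
    using s \<open>sets (m x) = sets borel\<close> by simp
  have "integrable (m x) (\<lambda>y. exp (f y) * indicator A y)"
  proof (rule integrable_const_bound[where B = "exp B"])
    show "AE y in m x. norm (exp (f y) * indicator A y) \<le> exp B"
      using B by (auto simp: indicator_def abs_le_iff)
  qed measurable
  then have "(\<integral>\<^sup>+y. ennreal (exp (f y) * indicator A y) \<partial>m x) = ennreal (transfer_operator m f (indicator A) x)"
    unfolding transfer_operator_def by (rule nn_integral_eq_integral) simp
  then show "emeasure (tilted_kernel m f x) A = emeasure (density (m x) (\<lambda>y. ennreal (exp (f y)))) A"
    using emeasure_tilted_kernel[OF m f A, of x]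
    by (subst emeasure_density) (auto simp: ennreal_mult' ennreal_indicator)
qed

lemma transfer_operator_eq_integral_tilted_kernel:
  fixes f \<phi> :: "'a::topological_space \<Rightarrow> real"
  assumes m: "transition_kernel m" and f: "f \<in> bcontfun" and [measurable]: "\<phi> \<in> borel_measurable borel"
  shows "transfer_operator m f \<phi> x = (\<integral>y. \<phi> y \<partial>tilted_kernel m f x)"
proof -
  have [measurable_cong]: "sets (m x) = sets borel"
    using m by (auto simp: transition_kernel_def)
  note bcontfun_measurable[OF f, measurable]
  show ?thesis
    unfolding tilted_kernel_eq_density[OF m f] transfer_operator_def
    by (subst integral_density) auto
qed

text \<open>Multiplication by \<open>exp f\<close> preserves bounded continuous functions, so the
  Feller property of \<open>m\<close> can be applied to the product of \<open>exp f\<close> with a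
  test function.\<close>

lemma feller_tilted_kernel:
  fixes f :: "'a::topological_space \<Rightarrow> real"
  assumes m: "transition_kernel m" and "feller m" and f: "f \<in> bcontfun"
  shows "feller (tilted_kernel m f)"
  unfolding feller_def
proof (intro allI impI)
  fix \<phi> :: "'a \<Rightarrow> real" assume \<phi>: "\<phi> \<in> bcontfun"
  obtain B where B: "\<And>y. \<bar>f y\<bar> \<le> B" using bcontfun_abs_bounded[OF f] by blast
  obtain C where C: "\<And>y. \<bar>\<phi> y\<bar> \<le> C" using bcontfun_abs_bounded[OF \<phi>] by blast
  have "continuous_on UNIV (\<lambda>y. exp (f y) * \<phi> y)"
    using f \<phi> by (auto simp: bcontfun_def intro!: continuous_intros)
  moreover have "\<bar>exp (f y) * \<phi> y\<bar> \<le> exp B * C" for y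
    using B[of y] C[of y] by (auto simp: abs_mult abs_le_iff intro!: mult_mono')
  ultimately have "(\<lambda>y. exp (f y) * \<phi> y) \<in> bcontfun"
    by (auto simp: bcontfun_def bounded_iff)
  then have "(\<lambda>x. transfer_operator m f \<phi> x) \<in> bcontfun"
    using \<open>feller m\<close> by (simp add: feller_def transfer_operator_def)
  then show "(\<lambda>x. \<integral>y. \<phi> y \<partial>tilted_kernel m f x) \<in> bcontfun"
    using transfer_operator_eq_integral_tilted_kernel[OF m f bcontfun_measurable[OF \<phi>]] by simp
qed

text \<open>This form makes the kernel a morphism of the Giry monad, so that \<open>bind\<close> can
  express one step of the chain.\<close>

lemma transition_kernel_measurable:
  assumes "transition_kernel K"
  shows "K \<in> borel \<rightarrow>\<^sub>M prob_algebra borel"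
  using assms by (intro measurable_prob_algebraI measurable_subprob_algebra)
    (auto simp: transition_kernel_def prob_space_imp_subprob_space
      finite_measure.emeasure_eq_measure prob_space.finite_measure)

section \<open>Empirical measures and weak-* accumulation points\<close>

text \<open>Choosing an index uniformly below \<open>n\<close> and evaluating the sequence there
  yields the empirical measure. Integrals against it thereby become finite averages.\<close>

lemma empirical_measure_eq_distr:
  assumes "n > 0"
  shows "empirical_measure x n = distr (uniform_count_measure {..<n}) borel x"
proof (rule measure_eqI)
  show s: "sets (empirical_measure x n) = sets (distr (uniform_count_measure {..<n}) borel x)"
    using sets.sigma_sets_eq[of "borel :: 'a measure"] by (simp add: empirical_measure_def)
  fix A assume "A \<in> sets (empirical_measure x n)"
  then have A: "A \<in> sets borel" using s by simp
  have "emeasure (distr (uniform_count_measure {..<n}) borel x) A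
      = ennreal (real (card (x -` A \<inter> {..<n})) / real n)"
    using A assms
    by (subst emeasure_distr) (auto simp: measurable_def space_uniform_count_measure
        sets_uniform_count_measure emeasure_uniform_count_measure)
  also have "real (card (x -` A \<inter> {..<n})) = (\<Sum>i<n. indicator A (x i))"
    by (simp add: indicator_def vimage_def Int_commute)
  also have "ennreal ((\<Sum>i<n. indicator A (x i)) / real n)
      = ennreal (1 / real n) * (\<Sum>i<n. indicator A (x i))"
    by (simp add: ennreal_mult' sum_nonneg divide_inverse mult.commute ennreal_indicator
        flip: sum_ennreal)
  also have "\<dots> = emeasure (empirical_measure x n) A"
    using A by (simp add: emeasure_empirical_measure)
  finally show "emeasure (empirical_measure x n) A = emeasure (distr (uniform_count_measure {..<n}) borel x) A"
    by simp
qed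

lemma integral_empirical_measure:
  fixes \<phi> :: "'a::topological_space \<Rightarrow> real"
  assumes "n > 0" and "\<phi> \<in> borel_measurable borel"
  shows "(\<integral>y. \<phi> y \<partial>empirical_measure x n) = (\<Sum>i<n. \<phi> (x i)) / real n"
proof -
  have "x \<in> uniform_count_measure {..<n} \<rightarrow>\<^sub>M borel"
    by (auto simp: measurable_def space_uniform_count_measure sets_uniform_count_measure)
  then show ?thesis
    using assms
    by (simp add: empirical_measure_eq_distr integral_distr integral_uniform_count_measure)
qed

text \<open>Evaluation at \<open>\<phi>\<close> is continuous by the very choice of the topology. A
  value other than \<open>c\<close> could be separated from \<open>c\<close> by disjoint open sets,
  and the integrals would be frequently in one and eventually in the other.\<close>

lemma accumulation_point_integral_eq:
  fixes \<phi> :: "'a::topological_space \<Rightarrow> real"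
  assumes acc: "accumulation_point_of weak_star_topology s \<nu>" and \<phi>: "\<phi> \<in> bcontfun"
    and lim: "(\<lambda>n. \<integral>y. \<phi> y \<partial>s n) \<longlonglongrightarrow> c"
  shows "(\<integral>y. \<phi> y \<partial>\<nu>) = c"
proof (rule ccontr)
  assume "(\<integral>y. \<phi> y \<partial>\<nu>) \<noteq> c"
  then obtain U V where UV: "open U" "open V" "(\<integral>y. \<phi> y \<partial>\<nu>) \<in> U" "c \<in> V" "U \<inter> V = {}"
    by (rule hausdorff[THEN exE]) blast
  let ?W = "{\<mu>. prob_space \<mu> \<and> sets \<mu> = sets borel \<and> (\<integral>y. \<phi> y \<partial>\<mu>) \<in> U}"
  have "openin weak_star_topology ?W"
    unfolding weak_star_topology_def using \<phi> UV(1) by (intro topology_generated_by_Basis) blast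
  moreover have "\<nu> \<in> ?W"
    using acc UV(3) by (simp add: accumulation_point_of_def topspace_weak_star_topology)
  ultimately have "\<exists>\<^sub>F n in sequentially. s n \<in> ?W"
    using acc unfolding accumulation_point_of_def by blast
  moreover have "\<forall>\<^sub>F n in sequentially. (\<integral>y. \<phi> y \<partial>s n) \<in> V"
    using lim UV by (auto dest: topological_tendstoD)
  ultimately have "\<exists>\<^sub>F n in sequentially. s n \<in> ?W \<and> (\<integral>y. \<phi> y \<partial>s n) \<in> V"
    by (rule frequently_rev_mp[OF _ eventually_mono]) auto
  then show False
    using UV(5) by (auto dest!: frequently_ex)
qed

section \<open>A countable generator of the Borel sets and its test functions\<close>

text \<open>A compact metric space is totally bounded, so finite nets at the scales
  \<open>1 / (n + 1)\<close> give a countable basis of balls. Closing it under finite intersections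
  keeps it countable and makes it a pi-system.\<close>

lemma compact_UNIV_countable_Int_stable_generator:
  assumes "compact (UNIV :: 'a::metric_space set)"
  obtains G :: "'a::metric_space set set"
  where "countable G" "Int_stable G" "UNIV \<in> G" "\<And>U. U \<in> G \<Longrightarrow> open U"
    "sets borel = sigma_sets UNIV G"
proof -
  have "seq_compact (UNIV :: 'a set)"
    using assms by (simp add: compact_eq_seq_compact_metric)
  note tb = seq_compact_imp_totally_bounded[OF this, rule_format]
  have "\<forall>n. \<exists>k. finite k \<and> k \<subseteq> UNIV \<and> (UNIV :: 'a set) \<subseteq> (\<Union>c\<in>k. ball c (1 / real (Suc n)))"
    by (intro allI tb) simp
  from choice[OF this] obtain k :: "nat \<Rightarrow> 'a set"
    where k: "\<And>n. finite (k n)" "\<And>n. UNIV \<subseteq> (\<Union>c\<in>k n. ball c (1 / real (Suc n)))"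
    by blast
  define B where "B = (\<Union>n. (\<lambda>c. ball c (1 / real (Suc n))) ` k n)"
  have countable: "countable B"
    unfolding B_def using k(1) by (auto intro: countable_finite)
  have basis: "topological_basis B"
  proof (rule topological_basisI)
    fix O' and y :: 'a assume O': "open O'" "y \<in> O'"
    then obtain e where e: "e > 0" "ball y e \<subseteq> O'"
      by (meson open_contains_ball)
    obtain n where n: "1 / real (Suc n) < e / 2"
      using e(1) nat_approx_posE[of "e / 2"] by auto
    obtain c where c: "c \<in> k n" "y \<in> ball c (1 / real (Suc n))"
      using k(2)[of n] by blast
    \<comment> \<open>The radius is below \<open>e / 2\<close> and \<open>y\<close> lies in the
      ball, so each of its points is within \<open>e\<close> of \<open>y\<close>.\<close>
    have "ball c (1 / real (Suc n)) \<subseteq> ball y e"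
    proof
      fix z assume "z \<in> ball c (1 / real (Suc n))"
      then show "z \<in> ball y e"
        using c(2) n dist_triangle[of y z c] by (simp add: dist_commute)
    qed
    then show "\<exists>B'\<in>B. y \<in> B' \<and> B' \<subseteq> O'"
      using c e(2) unfolding B_def by blast
  qed (auto simp: B_def)
  define G where "G = Inter ` {b. finite b \<and> b \<subseteq> B}"
  have open_G: "open U" if "U \<in> G" for U
    using that topological_basis_open[OF basis] unfolding G_def by (auto intro!: open_Inter)
  show thesis
  proof
    show "countable G"
      unfolding G_def using countable by (intro countable_image countable_Collect_finite_subset)
    show "Int_stable G"
    proof (rule Int_stableI)
      fix U V assume "U \<in> G" "V \<in> G"
      then obtain b c where "U = \<Inter>b" "V = \<Inter>c" "finite (b \<union> c)" "b \<union> c \<subseteq> B"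
        unfolding G_def by auto
      then show "U \<inter> V \<in> G"
        unfolding G_def by (metis (mono_tags, lifting) Inter_Un_distrib image_eqI mem_Collect_eq)
    qed
    show "UNIV \<in> G"
      unfolding G_def by (rule image_eqI[of _ _ "{}"]) auto
    show "open U" if "U \<in> G" for U using that by (rule open_G)
    have "B \<subseteq> G"
    proof
      fix b assume "b \<in> B"
      then show "b \<in> G" unfolding G_def by (intro image_eqI[of _ _ "{b}"]) auto
    qed
    have "sets borel = sigma_sets UNIV B"
      by (subst borel_eq_countable_basis[OF countable basis]) simp
    also have "\<dots> \<subseteq> sigma_sets UNIV G"
      using \<open>B \<subseteq> G\<close> by (rule sigma_sets_mono')
    finally have "sets borel \<subseteq> sigma_sets UNIV G" .
    moreover have "sigma_sets UNIV G \<subseteq> sets borel"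
      using sets.sigma_sets_subset[of G borel] open_G by force
    ultimately show "sets borel = sigma_sets UNIV G" by simp
  qed
qed

text \<open>Since \<open>infdist y {} = 0\<close>, the functions \<open>bump UNIV k\<close> vanish; \<open>U = UNIV\<close> is treated separately below.\<close>

definition bump :: "'a::metric_space set \<Rightarrow> nat \<Rightarrow> 'a \<Rightarrow> real" where
  "bump U k y = min 1 (real k * infdist y (- U))"

lemma abs_bump_le_1: "\<bar>bump U k y\<bar> \<le> 1"
proof -
  have "0 \<le> real k * infdist y (- U)"
    by (simp add: infdist_nonneg)
  then show ?thesis
    by (simp add: bump_def)
qed

lemma bump_in_bcontfun: "bump U k \<in> bcontfun"
proof -
  have "continuous_on UNIV (bump U k)"
    unfolding bump_def by (intro continuous_intros)
  then show ?thesis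
    using abs_bump_le_1 by (auto simp: bcontfun_def bounded_iff)
qed

text \<open>A point of \<open>U\<close> has positive distance from the closed nonempty complement,
  so the truncation at 1 is reached for all large \<open>k\<close>; outside \<open>U\<close> the
  distance is 0.\<close>

lemma bump_tendsto_indicator:
  assumes "open U" and "U \<noteq> UNIV"
  shows "(\<lambda>k. bump U k y) \<longlonglongrightarrow> indicator U y"
proof (cases "y \<in> U")
  case False
  then show ?thesis by (simp add: bump_def)
next
  case True
  then have pos: "infdist y (- U) > 0"
    using assms infdist_pos_not_in_closed[of "- U" y] by auto
  obtain N where N: "1 / infdist y (- U) < real N"
    using reals_Archimedean2 by blast
  have "bump U k y = 1" if "k \<ge> N" for k
  proof -
    have "1 < real N * infdist y (- U)"
      using pos N by (simp add: divide_less_eq)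
    also have "\<dots> \<le> real k * infdist y (- U)"
      using pos that by (intro mult_right_mono) auto
    finally show ?thesis by (simp add: bump_def)
  qed
  then have "eventually (\<lambda>k. bump U k y = 1) sequentially"
    by (auto simp: eventually_sequentially)
  then show ?thesis
    using True by (simp add: tendsto_eventually)
qed

text \<open>For a proper open set the measure is recovered from the test functions by dominated
  convergence. For \<open>UNIV\<close> both masses are 1.\<close>

lemma emeasure_open_eq_if_integral_bump_eq:
  assumes "prob_space M" "prob_space N" and sM: "sets M = sets borel" and sN: "sets N = sets borel"
    and U: "open U" and eq: "\<And>k. (\<integral>y. bump U k y \<partial>M) = (\<integral>y. bump U k y \<partial>N)"
  shows "emeasure M U = emeasure N U"
proof (cases "U = UNIV")
  case True
  then show ?thesis
    using prob_space.emeasure_space_1[OF assms(1)] prob_space.emeasure_space_1[OF assms(2)]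
      sets_eq_imp_space_eq[OF sM] sets_eq_imp_space_eq[OF sN] by simp
next
  case False
  have lim: "(\<lambda>k. \<integral>y. bump U k y \<partial>L) \<longlonglongrightarrow> measure L U"
    if "prob_space L" and s[measurable_cong]: "sets L = sets borel" for L
  proof -
    interpret prob_space L by fact
    note bcontfun_measurable[OF bump_in_bcontfun, measurable]
    have [measurable]: "U \<in> sets borel" using U by simp
    have "(\<lambda>k. \<integral>y. bump U k y \<partial>L) \<longlonglongrightarrow> (\<integral>y. indicator U y \<partial>L)"
    proof (rule integral_dominated_convergence[where w = "\<lambda>_. 1"])
      show "AE y in L. (\<lambda>k. bump U k y) \<longlonglongrightarrow> indicator U y"
        using bump_tendsto_indicator[OF U False] by simp
      show "AE y in L. norm (bump U k y) \<le> 1" for k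
        by (simp add: abs_bump_le_1)
    qed (simp_all, measurable)
    then show ?thesis using U s by simp
  qed
  have "measure M U = measure N U"
    using lim[OF assms(1) sM] lim[OF assms(2) sN] eq by (auto intro: LIMSEQ_unique)
  then show ?thesis
    using assms(1,2) by (simp add: finite_measure.emeasure_eq_measure prob_space.finite_measure)
qed


section \<open>Stationarity from countably many test functions\<close>

text \<open>The left side of \<open>eq\<close> is the integral of the test function against
  \<open>\<nu> \<bind> K\<close>. Hence \<open>\<nu> \<bind> K\<close> and \<open>\<nu>\<close>
  agree on the open sets in \<open>G\<close>, and by uniqueness on a generating pi-system they
  coincide. The equation of measures is kept as a second conclusion because it can be integrated
  against any bounded continuous function.\<close>

lemma stationary_measureI:
  fixes K :: "'a::metric_space \<Rightarrow> 'a measure"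
  assumes K: "transition_kernel K" and \<nu>: "prob_space \<nu>" "sets \<nu> = sets borel"
    and G: "Int_stable G" "UNIV \<in> G" "\<And>U. U \<in> G \<Longrightarrow> open U" "sets borel = sigma_sets UNIV G"
    and eq: "\<And>U k. U \<in> G \<Longrightarrow> (\<integral>y. \<integral>z. bump U k z \<partial>K y \<partial>\<nu>) = (\<integral>y. bump U k y \<partial>\<nu>)"
  shows "stationary_measure K \<nu>" and "\<nu> \<bind> K = \<nu>"
proof -
  interpret prob_space \<nu> by fact
  note \<nu>(2)[measurable_cong]
  have K_meas: "K \<in> \<nu> \<rightarrow>\<^sub>M prob_algebra borel"
    using transition_kernel_measurable[OF K] by measurable
  note K_sub = measurable_prob_algebraD[OF K_meas]
  have K_prob: "prob_space (K y)" "sets (K y) = sets borel" for y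
    using K by (auto simp: transition_kernel_def)
  have s: "sets (\<nu> \<bind> K) = sets borel"
    using K_prob(2) not_empty by (rule sets_bind)
  have p: "prob_space (\<nu> \<bind> K)"
    using K_prob(1) by (intro prob_space_bind[OF _ K_sub]) simp
  show bind: "\<nu> \<bind> K = \<nu>"
  proof (rule measure_eqI_generator_eq[where E = G and \<Omega> = UNIV and A = "\<lambda>_. UNIV"])
    fix U assume U: "U \<in> G"
    have "(\<integral>y. bump U k y \<partial>(\<nu> \<bind> K)) = (\<integral>y. bump U k y \<partial>\<nu>)" for k
      unfolding eq[OF U, symmetric]
      using K_prob(1)
      by (intro integral_bind[OF bcontfun_measurable[OF bump_in_bcontfun] abs_bump_le_1 K_sub, where B' = 1])
        (auto simp: prob_space.emeasure_space_1 intro: finite_measure_axioms)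
    then show "emeasure (\<nu> \<bind> K) U = emeasure \<nu> U"
      by (intro emeasure_open_eq_if_integral_bump_eq p s \<nu> G(3) U)
  next
    show "emeasure (\<nu> \<bind> K) UNIV \<noteq> \<infinity>" for i :: nat
      using prob_space.emeasure_space_1[OF p] sets_eq_imp_space_eq[OF s] by simp
  qed (use G s \<nu>(2) in auto)
  show "stationary_measure K \<nu>"
    unfolding stationary_measure_def
  proof (intro conjI ballI \<nu>)
    fix A :: "'a set" assume "A \<in> sets borel"
    then show "(\<integral>\<^sup>+y. emeasure (K y) A \<partial>\<nu>) = emeasure \<nu> A"
      using emeasure_bind[OF not_empty K_sub, of A] bind by simp
  qed
qed

section \<open>Martingale increments of the Markov chain\<close>

lemma subalgebra_past:
  assumes "\<And>i. \<Psi> i \<in> borel_measurable P"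
  shows "subalgebra P (past P \<Psi> n)"
proof -
  have "sets (past P \<Psi> n) = sigma_sets (space P) {\<Psi> i -` A \<inter> space P | i A. i \<le> n \<and> A \<in> sets borel}"
    unfolding past_def by (intro sets_measure_of) auto
  also have "\<dots> \<subseteq> sets P"
    using assms by (intro sets.sigma_sets_subset) (auto intro: measurable_sets)
  finally show ?thesis
    by (simp add: subalgebra_def) (simp add: past_def space_measure_of_conv)
qed

lemma measurable_past:
  fixes \<Psi> :: "nat \<Rightarrow> 'w \<Rightarrow> 'a::topological_space"
  assumes "i \<le> n"
  shows "\<Psi> i \<in> past P \<Psi> n \<rightarrow>\<^sub>M borel"
proof (rule measurableI)
  fix A :: "'a set" assume "A \<in> sets borel"
  then show "\<Psi> i -` A \<inter> space (past P \<Psi> n) \<in> sets (past P \<Psi> n)"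
    unfolding past_def space_measure_of_conv using assms
    by (subst sets_measure_of) auto
qed simp

lemma transition_kernel_integral_measurable:
  fixes \<phi> :: "'a::topological_space \<Rightarrow> real"
  assumes K: "transition_kernel K" and \<phi>: "\<phi> \<in> borel_measurable borel"
  shows "(\<lambda>x. \<integral>y. \<phi> y \<partial>K x) \<in> borel_measurable borel"
  by (rule measurable_compose[OF measurable_prob_algebraD[OF transition_kernel_measurable[OF K]]
        integral_measurable_subprob_algebra[OF \<phi>]])

lemma transition_kernel_abs_integral_le:
  fixes \<phi> :: "'a::topological_space \<Rightarrow> real"
  assumes K: "transition_kernel K" and \<phi>[measurable]: "\<phi> \<in> borel_measurable borel"
    and bound: "\<And>y. \<bar>\<phi> y\<bar> \<le> B"
  shows "\<bar>\<integral>y. \<phi> y \<partial>K x\<bar> \<le> B"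
proof -
  interpret prob_space "K x" using K by (simp add: transition_kernel_def)
  have [measurable_cong]: "sets (K x) = sets borel"
    using K by (simp add: transition_kernel_def)
  have "integrable (K x) \<phi>"
    by (rule integrable_const_bound[where B = B]) (use bound in auto)
  moreover have "- B \<le> \<phi> y" "\<phi> y \<le> B" for y
    using bound[of y] by (auto simp: abs_le_iff)
  ultimately show ?thesis
    unfolding abs_le_iff using integral_ge_const[of \<phi> "- B"] integral_le_const[of \<phi> B] by auto
qed

text \<open>The Markov property is stated for indicators only. A nonnegative weight can be used as a
  density, which turns the property into an equality of finite measures and so reaches bounded
  \<open>\<phi>\<close> without approximation by simple functions.\<close>

lemma markov_chain_integral_step_nonneg:
  fixes \<phi> :: "'a::topological_space \<Rightarrow> real"
  assumes K: "transition_kernel K" and mc: "markov_chain P K x \<Psi>"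
    and \<phi>[measurable]: "\<phi> \<in> borel_measurable borel" and \<phi>_bound: "\<And>y. \<bar>\<phi> y\<bar> \<le> B"
    and Z: "Z \<in> borel_measurable (past P \<Psi> n)" and Z_bound: "\<And>\<omega>. 0 \<le> Z \<omega>" "\<And>\<omega>. Z \<omega> \<le> C"
  shows "(\<integral>\<omega>. Z \<omega> * \<phi> (\<Psi> (Suc n) \<omega>) \<partial>P) = (\<integral>\<omega>. Z \<omega> * (\<integral>y. \<phi> y \<partial>K (\<Psi> n \<omega>)) \<partial>P)"
proof -
  interpret prob_space P using mc by (simp add: markov_chain_def)
  have \<Psi>[measurable]: "\<Psi> i \<in> borel_measurable P" for i
    using mc by (simp add: markov_chain_def)
  have sub: "subalgebra P (past P \<Psi> n)"
    by (rule subalgebra_past) measurable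
  have Z_meas[measurable]: "Z \<in> borel_measurable P"
    by (rule measurable_from_subalg[OF sub Z])
  have "finite_measure_subalgebra P (past P \<Psi> n)"
    using sub by unfold_locales
  then interpret sigma_finite_subalgebra P "past P \<Psi> n"
    by (rule finite_measure_subalgebra_is_sigma_finite)
  have K_prob: "prob_space (K y)" "sets (K y) = sets borel" for y
    using K by (auto simp: transition_kernel_def)
  note K_meas = measurable_prob_algebraD[OF transition_kernel_measurable[OF K], measurable]
  \<comment> \<open>The factor \<open>g\<close> will be the constant 1, an indicator along the
    chain, or the kernel's mass of a set.\<close>
  have Z_int: "integrable P (\<lambda>\<omega>. Z \<omega> * g \<omega>)"
    if [measurable]: "g \<in> borel_measurable P" and "\<And>\<omega>. 0 \<le> g \<omega>" "\<And>\<omega>. g \<omega> \<le> 1" for g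
  proof (rule integrable_const_bound[where B = C])
    show "AE \<omega> in P. norm (Z \<omega> * g \<omega>) \<le> C"
      using that mult_mono'[OF Z_bound(2) that(3) Z_bound(1) that(2)] Z_bound by (simp add: abs_mult)
  qed measurable
  \<comment> \<open>The Markov property says that the law of \<open>\<Psi>\<^bsub>n+1\<^esub>\<close> under \<open>Q = Z P\<close> is the law of \<open>\<Psi>\<^bsub>n\<^esub>\<close> under \<open>Q\<close>
    pushed through \<open>K\<close>.\<close>
  define Q where "Q = density P (\<lambda>\<omega>. ennreal (Z \<omega>))"
  have Q_sets[measurable_cong]: "sets Q = sets P" and Q_space: "space Q = space P"
    by (simp_all add: Q_def)
  have Q_ne: "space Q \<noteq> {}"
    using not_empty by (simp add: Q_space)
  have Q_finite: "finite_measure Q"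
  proof (rule finite_measureI)
    have "emeasure Q (space Q) = (\<integral>\<^sup>+\<omega>. ennreal (Z \<omega>) \<partial>P)"
      unfolding Q_def by (simp add: emeasure_density cong: nn_integral_cong)
    also have "\<dots> = ennreal (\<integral>\<omega>. Z \<omega> \<partial>P)"
      using Z_int[of "\<lambda>_. 1"] Z_bound by (intro nn_integral_eq_integral) auto
    finally show "emeasure Q (space Q) \<noteq> \<infinity>" by simp
  qed
  have K\<Psi>: "(\<lambda>\<omega>. K (\<Psi> n \<omega>)) \<in> Q \<rightarrow>\<^sub>M subprob_algebra borel"
    by measurable
  have "distr Q borel (\<Psi> (Suc n)) = Q \<bind> (\<lambda>\<omega>. K (\<Psi> n \<omega>))"
  proof (rule measure_eqI)
    show "sets (distr Q borel (\<Psi> (Suc n))) = sets (Q \<bind> (\<lambda>\<omega>. K (\<Psi> n \<omega>)))"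
      using K_prob(2) Q_ne by (subst sets_bind[where N = borel]) auto
    fix A assume "A \<in> sets (distr Q borel (\<Psi> (Suc n)))"
    then have A[measurable]: "A \<in> sets borel" by simp
    have KA[measurable]: "(\<lambda>y. measure (K y) A) \<in> borel_measurable borel"
      using K A by (simp add: transition_kernel_def)
    have KA1: "measure (K y) A \<le> 1" for y
      using prob_space.prob_le_1[OF K_prob(1)] .
    have "emeasure (distr Q borel (\<Psi> (Suc n))) A = emeasure Q (\<Psi> (Suc n) -` A \<inter> space P)"
      by (subst emeasure_distr) (simp_all add: Q_space)
    also have "\<dots> = (\<integral>\<^sup>+\<omega>. ennreal (Z \<omega> * indicator A (\<Psi> (Suc n) \<omega>)) \<partial>P)"
      unfolding Q_def using Z_bound
      by (subst emeasure_density)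
        (auto simp: ennreal_mult' indicator_def intro!: nn_integral_cong)
    also have "\<dots> = ennreal (\<integral>\<omega>. Z \<omega> * indicator A (\<Psi> (Suc n) \<omega>) \<partial>P)"
      using Z_bound by (intro nn_integral_eq_integral Z_int) (auto simp: indicator_def)
    \<comment> \<open>Because \<open>Z\<close> is measurable with respect to the past, the indicator
      may be replaced by its conditional expectation under the integral, and the Markov property
      then identifies the latter.\<close>
    also have "(\<integral>\<omega>. Z \<omega> * indicator A (\<Psi> (Suc n) \<omega>) \<partial>P)
        = (\<integral>\<omega>. Z \<omega> * real_cond_exp P (past P \<Psi> n) (\<lambda>\<omega>. indicator A (\<Psi> (Suc n) \<omega>)) \<omega> \<partial>P)"
      by (rule real_cond_exp_intg(2)[symmetric, OF Z_int Z]) (auto simp: indicator_def)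
    also have "\<dots> = (\<integral>\<omega>. Z \<omega> * measure (K (\<Psi> n \<omega>)) A \<partial>P)"
    proof (rule integral_cong_AE)
      have "AE \<omega> in P. real_cond_exp P (past P \<Psi> n) (\<lambda>\<omega>. indicator A (\<Psi> (Suc n) \<omega>)) \<omega>
          = measure (K (\<Psi> n \<omega>)) A"
        using mc A by (simp add: markov_chain_def)
      then show "AE \<omega> in P. Z \<omega> * real_cond_exp P (past P \<Psi> n) (\<lambda>\<omega>. indicator A (\<Psi> (Suc n) \<omega>)) \<omega>
          = Z \<omega> * measure (K (\<Psi> n \<omega>)) A"
        by eventually_elim simp
    qed measurable
    also have "ennreal (\<integral>\<omega>. Z \<omega> * measure (K (\<Psi> n \<omega>)) A \<partial>P)
        = (\<integral>\<^sup>+\<omega>. ennreal (Z \<omega> * measure (K (\<Psi> n \<omega>)) A) \<partial>P)"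
      using Z_bound KA1 by (intro nn_integral_eq_integral[symmetric] Z_int) auto
    also have "\<dots> = (\<integral>\<^sup>+\<omega>. emeasure (K (\<Psi> n \<omega>)) A \<partial>Q)"
      unfolding Q_def using K_prob(1) Z_bound(1)
      by (subst nn_integral_density)
        (auto simp: ennreal_mult' finite_measure.emeasure_eq_measure prob_space.finite_measure)
    also have "\<dots> = emeasure (Q \<bind> (\<lambda>\<omega>. K (\<Psi> n \<omega>))) A"
      by (rule emeasure_bind[symmetric, OF Q_ne K\<Psi> A])
    finally show "emeasure (distr Q borel (\<Psi> (Suc n))) A = emeasure (Q \<bind> (\<lambda>\<omega>. K (\<Psi> n \<omega>))) A" .
  qed
  then have "(\<integral>\<omega>. \<phi> (\<Psi> (Suc n) \<omega>) \<partial>Q) = (\<integral>y. \<phi> y \<partial>(Q \<bind> (\<lambda>\<omega>. K (\<Psi> n \<omega>))))"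
    by (subst integral_distr[symmetric, where N = borel]) simp_all
  also have "\<dots> = (\<integral>\<omega>. \<integral>y. \<phi> y \<partial>K (\<Psi> n \<omega>) \<partial>Q)"
    using K_prob(1)
    by (intro integral_bind[OF \<phi> \<phi>_bound K\<Psi> Q_finite, where B' = 1])
      (auto simp: prob_space.emeasure_space_1)
  finally show ?thesis
    unfolding Q_def using Z_bound(1) transition_kernel_integral_measurable[OF K \<phi>]
    by (subst (asm) (1 2) integral_density) auto
qed

text \<open>With the sum of the earlier increments as \<open>Z\<close>, this is the orthogonality
  that \<open>strong_law_orthogonal_increments\<close> asks for.\<close>

lemma markov_chain_integral_step:
  fixes \<phi> :: "'a::topological_space \<Rightarrow> real"
  assumes K: "transition_kernel K" and mc: "markov_chain P K x \<Psi>"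
    and \<phi>[measurable]: "\<phi> \<in> borel_measurable borel" and \<phi>_bound: "\<And>y. \<bar>\<phi> y\<bar> \<le> B"
    and Z: "Z \<in> borel_measurable (past P \<Psi> n)" and Z_bound: "\<And>\<omega>. \<bar>Z \<omega>\<bar> \<le> C"
  shows "(\<integral>\<omega>. Z \<omega> * (\<phi> (\<Psi> (Suc n) \<omega>) - (\<integral>y. \<phi> y \<partial>K (\<Psi> n \<omega>))) \<partial>P) = 0"
proof -
  interpret prob_space P using mc by (simp add: markov_chain_def)
  have \<Psi>[measurable]: "\<Psi> i \<in> borel_measurable P" for i
    using mc by (simp add: markov_chain_def)
  have Z_meas[measurable]: "Z \<in> borel_measurable P"
    by (rule measurable_from_subalg[OF subalgebra_past Z]) measurable
  note [measurable] = transition_kernel_integral_measurable[OF K \<phi>]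
  have C: "0 \<le> C" using Z_bound abs_ge_zero order_trans by blast
  let ?X = "\<lambda>\<omega>. \<phi> (\<Psi> (Suc n) \<omega>)" and ?Y = "\<lambda>\<omega>. \<integral>y. \<phi> y \<partial>K (\<Psi> n \<omega>)"
  have int: "integrable P g" if [measurable]: "g \<in> borel_measurable P" and "\<And>\<omega>. \<bar>g \<omega>\<bar> \<le> b" for g :: "_ \<Rightarrow> real" and b
    by (rule integrable_const_bound[where B = b]) (use that in auto)
  have Y_bound: "\<bar>?Y \<omega>\<bar> \<le> B" for \<omega>
    by (rule transition_kernel_abs_integral_le[OF K \<phi> \<phi>_bound])
  have ints: "integrable P ?X" "integrable P ?Y"
    by (rule int[of _ B]; simp add: \<phi>_bound Y_bound)+
  have ZX: "integrable P (\<lambda>\<omega>. Z \<omega> * ?X \<omega>)" and ZY: "integrable P (\<lambda>\<omega>. Z \<omega> * ?Y \<omega>)"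
    by (rule int[of _ "C * B"], measurable, simp add: abs_mult mult_mono' Z_bound \<phi>_bound Y_bound)+
  have Z_shift: "0 \<le> Z \<omega> + C" "Z \<omega> + C \<le> 2 * C" for \<omega>
    using Z_bound[of \<omega>] by linarith+
  \<comment> \<open>The step for nonnegative weights is applied to \<open>Z + C\<close> and to \<open>C\<close>.\<close>
  have shifted: "(\<integral>\<omega>. (Z \<omega> + C) * ?X \<omega> \<partial>P) = (\<integral>\<omega>. (Z \<omega> + C) * ?Y \<omega> \<partial>P)"
    by (rule markov_chain_integral_step_nonneg[OF K mc \<phi> \<phi>_bound borel_measurable_add[OF Z] Z_shift]) simp
  have const: "(\<integral>\<omega>. C * ?X \<omega> \<partial>P) = (\<integral>\<omega>. C * ?Y \<omega> \<partial>P)"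
    by (rule markov_chain_integral_step_nonneg[OF K mc \<phi> \<phi>_bound _ C order_refl]) simp
  show ?thesis
    using shifted const ints ZX ZY by (auto simp: distrib_right right_diff_distrib)
qed

text \<open>The martingale increments compare the kernel average at time \<open>i\<close> with
  \<open>\<phi>\<close> at time \<open>i + 1\<close>. Moving \<open>\<phi>\<close> back to time
  \<open>i\<close> costs a telescoping sum, hence a bounded boundary term that vanishes after
  division by \<open>n\<close>.\<close>

lemma markov_chain_strong_law:
  fixes \<phi> :: "'a::topological_space \<Rightarrow> real"
  assumes K: "transition_kernel K" and mc: "markov_chain P K x \<Psi>"
    and \<phi>[measurable]: "\<phi> \<in> borel_measurable borel" and \<phi>_bound: "\<And>y. \<bar>\<phi> y\<bar> \<le> B"
  shows "AE \<omega> in P. (\<lambda>n. (\<Sum>i<n. (\<integral>y. \<phi> y \<partial>K (\<Psi> i \<omega>)) - \<phi> (\<Psi> i \<omega>)) / real n) \<longlonglongrightarrow> 0"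
proof -
  interpret prob_space P using mc by (simp add: markov_chain_def)
  have \<Psi>[measurable]: "\<Psi> i \<in> borel_measurable P" for i
    using mc by (simp add: markov_chain_def)
  note K\<phi>[measurable] = transition_kernel_integral_measurable[OF K \<phi>]
  define D where "D i \<omega> = \<phi> (\<Psi> (Suc i) \<omega>) - (\<integral>y. \<phi> y \<partial>K (\<Psi> i \<omega>))" for i \<omega>
  have D_bound: "\<bar>D i \<omega>\<bar> \<le> 2 * B" for i \<omega>
    using \<phi>_bound[of "\<Psi> (Suc i) \<omega>"] transition_kernel_abs_integral_le[OF K \<phi> \<phi>_bound, of "\<Psi> i \<omega>"]
    unfolding D_def by linarith
  have sum_bound: "\<bar>\<Sum>i<n. D i \<omega>\<bar> \<le> real n * (2 * B)" for n \<omega>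
  proof -
    have "\<bar>\<Sum>i<n. D i \<omega>\<bar> \<le> (\<Sum>i<n. 2 * B)"
      by (rule order_trans[OF sum_abs sum_mono]) (rule D_bound)
    then show ?thesis by simp
  qed
  have "AE \<omega> in P. (\<lambda>n. (\<Sum>i<n. D i \<omega>) / real n) \<longlonglongrightarrow> 0"
  proof (rule strong_law_orthogonal_increments[OF _ D_bound])
    show "D i \<in> borel_measurable P" for i
      unfolding D_def by measurable
    fix n
    \<comment> \<open>The increment \<open>D i\<close> involves \<open>\<Psi> (Suc i)\<close>, so
      the sum over \<open>i < n\<close> uses the chain exactly up to time \<open>n\<close>.\<close>
    have "(\<lambda>\<omega>. \<Sum>i<n. D i \<omega>) \<in> borel_measurable (past P \<Psi> n)"
      unfolding D_def
      by (intro borel_measurable_sum borel_measurable_diff measurable_compose[OF _ \<phi>]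
          measurable_compose[OF _ K\<phi>] measurable_past) auto
    then show "expectation (\<lambda>\<omega>. (\<Sum>i<n. D i \<omega>) * D n \<omega>) = 0"
      using markov_chain_integral_step[OF K mc \<phi> \<phi>_bound _ sum_bound] by (simp add: D_def)
  qed
  then show ?thesis
  proof eventually_elim
    case (elim \<omega>)
    have "(\<Sum>i<n. (\<integral>y. \<phi> y \<partial>K (\<Psi> i \<omega>)) - \<phi> (\<Psi> i \<omega>)) = (\<phi> (\<Psi> n \<omega>) - \<phi> (\<Psi> 0 \<omega>)) - (\<Sum>i<n. D i \<omega>)" for n
      unfolding D_def sum_lessThan_telescope[of "\<lambda>i. \<phi> (\<Psi> i \<omega>)", symmetric] sum_subtractf[symmetric]
      by simp
    moreover have "(\<lambda>n. (\<phi> (\<Psi> n \<omega>) - \<phi> (\<Psi> 0 \<omega>)) / real n) \<longlonglongrightarrow> 0"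
    proof (rule Lim_null_comparison)
      have "\<bar>\<phi> (\<Psi> n \<omega>) - \<phi> (\<Psi> 0 \<omega>)\<bar> \<le> 2 * B" for n
        using \<phi>_bound[of "\<Psi> n \<omega>"] \<phi>_bound[of "\<Psi> 0 \<omega>"] by linarith
      then show "\<forall>\<^sub>F n in sequentially. norm ((\<phi> (\<Psi> n \<omega>) - \<phi> (\<Psi> 0 \<omega>)) / real n) \<le> 2 * B / real n"
        by (intro always_eventually) (simp add: divide_right_mono)
      show "(\<lambda>n. 2 * B / real n) \<longlonglongrightarrow> 0"
        by (rule lim_const_over_n)
    qed
    ultimately show ?case
      using tendsto_diff[OF _ elim] by (simp add: diff_divide_distrib)
  qed
qed

section \<open>Accumulation points of the empirical measures along the chain\<close>

theorem corollary4p3: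
  fixes m :: "'a::metric_space \<Rightarrow> 'a measure"
    and f :: "'a \<Rightarrow> real"
    and P :: "'w measure"
    and \<Psi> :: "nat \<Rightarrow> 'w \<Rightarrow> 'a"
    and x :: 'a
  assumes "compact (UNIV :: 'a set)"
    and "transition_kernel m"
    and "feller m"
    and "f \<in> bcontfun"
    and "normalized_potential m f"
    and "markov_chain P (tilted_kernel m f) x \<Psi>"
  shows "AE \<omega> in P. \<forall>\<nu>.
           accumulation_point_of weak_star_topology (empirical_measure (\<lambda>i. \<Psi> i \<omega>)) \<nu> \<longrightarrow>
           stationary_measure (tilted_kernel m f) \<nu> \<and> dual_fixed_point m f \<nu>"
proof -
  define K where "K = tilted_kernel m f"
  have K: "transition_kernel K"
    unfolding K_def by (rule transition_kernel_tilted_kernel[OF assms(2,4,5)])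
  have feller_K: "feller K"
    unfolding K_def by (rule feller_tilted_kernel[OF assms(2,3,4)])
  have mc: "markov_chain P K x \<Psi>"
    using assms(6) by (simp add: K_def)
  obtain G :: "'a set set" where G: "countable G" "Int_stable G" "UNIV \<in> G"
    "\<And>U. U \<in> G \<Longrightarrow> open U" "sets borel = sigma_sets UNIV G"
    using compact_UNIV_countable_Int_stable_generator[OF assms(1)] by blast
  \<comment> \<open>Countability of \<open>G\<close> and of the range of \<open>k\<close> yields a
    single null set. It is fixed before any \<open>\<nu>\<close> is chosen, so it serves all
    accumulation points at once.\<close>
  have "AE \<omega> in P. \<forall>U\<in>G. \<forall>k. (\<lambda>n. (\<Sum>i<n. (\<integral>y. bump U k y \<partial>K (\<Psi> i \<omega>)) - bump U k (\<Psi> i \<omega>)) / real n) \<longlonglongrightarrow> 0"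
    using G(1)
    by (auto simp: AE_ball_countable AE_all_countable
        intro!: markov_chain_strong_law[OF K mc bcontfun_measurable[OF bump_in_bcontfun] abs_bump_le_1])
  then show ?thesis
  proof (rule AE_mp, intro AE_I2 impI allI)
    fix \<omega> \<nu>
    assume lim: "\<forall>U\<in>G. \<forall>k. (\<lambda>n. (\<Sum>i<n. (\<integral>y. bump U k y \<partial>K (\<Psi> i \<omega>)) - bump U k (\<Psi> i \<omega>)) / real n) \<longlonglongrightarrow> 0"
      and acc: "accumulation_point_of weak_star_topology (empirical_measure (\<lambda>i. \<Psi> i \<omega>)) \<nu>"
    have \<nu>: "prob_space \<nu>" "sets \<nu> = sets borel"
      using acc by (auto simp: accumulation_point_of_def topspace_weak_star_topology)
    interpret prob_space \<nu> by fact
    note \<nu>(2)[measurable_cong]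
    have int: "integrable \<nu> \<phi>" if \<phi>: "\<phi> \<in> bcontfun" for \<phi> :: "'a \<Rightarrow> real"
    proof -
      obtain B where B: "\<And>y. \<bar>\<phi> y\<bar> \<le> B" using bcontfun_abs_bounded[OF \<phi>] by blast
      note bcontfun_measurable[OF \<phi>, measurable]
      show ?thesis
        by (rule integrable_const_bound[where B = B]) (use B in auto)
    qed
    have eq: "(\<integral>y. \<integral>z. bump U k z \<partial>K y \<partial>\<nu>) = (\<integral>y. bump U k y \<partial>\<nu>)" if U: "U \<in> G" for U k
    proof -
      \<comment> \<open>By the Feller property \<open>\<psi>\<close> is bounded and continuous,
        hence visible to the weak-* topology; its empirical averages are the sequence in
        \<open>lim\<close>.\<close>
      define \<psi> where "\<psi> y = (\<integral>z. bump U k z \<partial>K y) - bump U k y" for y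
      have K\<phi>: "(\<lambda>y. \<integral>z. bump U k z \<partial>K y) \<in> bcontfun"
        using feller_K bump_in_bcontfun by (auto simp: feller_def)
      have \<psi>: "\<psi> \<in> bcontfun"
        unfolding \<psi>_def using K\<phi> bump_in_bcontfun by (rule minus_cont)
      have "(\<lambda>n. \<integral>y. \<psi> y \<partial>empirical_measure (\<lambda>i. \<Psi> i \<omega>) n) \<longlonglongrightarrow> 0"
      proof (rule Lim_transform_eventually)
        show "(\<lambda>n. (\<Sum>i<n. \<psi> (\<Psi> i \<omega>)) / real n) \<longlonglongrightarrow> 0"
          using lim U by (simp add: \<psi>_def)
        show "\<forall>\<^sub>F n in sequentially. (\<Sum>i<n. \<psi> (\<Psi> i \<omega>)) / real n = (\<integral>y. \<psi> y \<partial>empirical_measure (\<lambda>i. \<Psi> i \<omega>) n)"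
          using eventually_gt_at_top[of 0]
          by eventually_elim (simp add: integral_empirical_measure bcontfun_measurable[OF \<psi>])
      qed
      then have "(\<integral>y. \<psi> y \<partial>\<nu>) = 0"
        by (rule accumulation_point_integral_eq[OF acc \<psi>])
      then show ?thesis
        unfolding \<psi>_def using int[OF K\<phi>] int[OF bump_in_bcontfun] by simp
    qed
    have bind: "\<nu> \<bind> K = \<nu>" and stationary: "stationary_measure K \<nu>"
      using stationary_measureI[OF K \<nu> G(2-5) eq] by blast+
    \<comment> \<open>The transfer operator is integration against \<open>K\<close>, so the dual
      equation is \<open>bind\<close> integrated against \<open>\<phi>\<close>.\<close>
    have "dual_fixed_point m f \<nu>"
      unfolding dual_fixed_point_def
    proof
      fix \<phi> :: "'a \<Rightarrow> real" assume \<phi>: "\<phi> \<in> bcontfun"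
      obtain B where B: "\<And>y. \<bar>\<phi> y\<bar> \<le> B" using bcontfun_abs_bounded[OF \<phi>] by blast
      have K_sub: "K \<in> \<nu> \<rightarrow>\<^sub>M subprob_algebra borel"
        using measurable_prob_algebraD[OF transition_kernel_measurable[OF K]] by measurable
      have "(\<integral>y. transfer_operator m f \<phi> y \<partial>\<nu>) = (\<integral>y. \<integral>z. \<phi> z \<partial>K y \<partial>\<nu>)"
        by (simp add: K_def transfer_operator_eq_integral_tilted_kernel[OF assms(2,4) bcontfun_measurable[OF \<phi>]])
      also have "\<dots> = (\<integral>y. \<phi> y \<partial>(\<nu> \<bind> K))"
        using K
        by (intro integral_bind[symmetric, OF bcontfun_measurable[OF \<phi>] _ K_sub, where B' = 1, of B])
          (auto simp: transition_kernel_def prob_space.emeasure_space_1 B intro: finite_measure_axioms)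
      finally show "(\<integral>y. transfer_operator m f \<phi> y \<partial>\<nu>) = (\<integral>y. \<phi> y \<partial>\<nu>)"
        by (simp add: bind)
    qed
    with stationary show "stationary_measure (tilted_kernel m f) \<nu> \<and> dual_fixed_point m f \<nu>"
      by (simp add: K_def)
  qed
qed

end
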